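(* Let $\alpha\in[0,1)$, let $c_\alpha\in(0,\tfrac\pi2]$ be the number with $\frac{\sin(2c_\alpha)}{2c_\alpha}=\alpha^2$, and let $(\mathbf u^n)_{0\le n\le M}$ be the solution of the discrete scheme with spatial mesh size $h=\frac1{N+1}$ and time step $\Delta t=\frac TM$ (as described in the context). Assume $\|\mathbf u^0\|_\infty\le\min\{\tfrac\pi4,c_\alpha\}$ and define $d_\alpha:=\|D^{-\alpha}\mathbf u^0\|_\infty$. Then the following holds for all $0\le n\le M-1$: (a) If $\Delta t\le\tfrac34 d_\alpha^{-2}h^{2(1-\alpha)}$, then $$\mathcal E_h(\mathbf u^{n+1})\le\mathcal E_h(\mathbf u^n).$$ (b) If $\alpha>\tfrac12$, then, with $u$ the sufficiently smooth solution of the continuous problem with initial condition $u_0$, $$\mathcal E_h(\mathbf u^{n+1})\le\mathcal E_h(\mathbf u^n)+\tfrac{64}{3}c^2d_\alpha^2\big(h^{2(\alpha-1)}(\Delta t)^2+h^{2(\alpha+1)}|\ln h|\big),$$ where $c$ is the constant in the discretization error estimate $$\|\mathbf u(t_m)-\mathbf u^m\|_{D,h}\le c\,\big(\Delta t+h^2|\ln h|^{1/2}\big),\qquad 1\le m\le M,$$ with $t_m=m\Delta t$, $\mathbf u(t)=(u(x_1,t),\ldots,u(x_N,t))^T$. That is, there is a constant $c$, depending only on $\big\|\frac{\partial^j u}{\partial x^j}\big\|_{L^\infty([0,1]\times[0,T])}$ ($0\le j\le4$), $\big\|\frac{\partial^j u}{\partial t^j}\big\|_{L^\infty([0,1]\times[0,T])}$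 ($0\le j\le2$), $T$, $\alpha$, $c_\alpha$ and $d_\alpha$, for which both this error estimate and the energy estimate in (b) hold.
   Context: Continuous problem. Let $I=[0,1]$, $T>0$ and $u_0:I\to\mathbb R$ with $u_0(0)=u_0(1)=0$. The problem is to find $u:I\times[0,T]\to\mathbb R$ with $$u_t=u_{xx}+\frac1x u_x-\frac{\sin(2u)}{2x^2}$$ (the equation being imposed for $x>0$), $u(\cdot,0)=u_0$ on $I$, and $u(0,t)=u(1,t)=0$ for $t\in[0,T]$. "Sufficiently smooth" means that the partial derivatives $\partial_x^j u$ ($0\le j\le4$) and $\partial_t^j u$ ($0\le j\le2$) exist and are continuous on $I\times[0,T]$. Discretization. Let $N\in\mathbb N$, $h=\frac{1}{N+1}$, $x_i=ih$ for $0\le i\le N+1$. Define the $N\times N$ matrices $$A=\frac1{h^2}\mathrm{tridiag}(-1,2,-1),\quad B=\frac1{2h}\mathrm{tridiag}(-1,0,1),\quad D=\mathrm{diag}(x_1,\ldots,x_N),\quad C=A-D^{-1}B.$$ For $\mathbf u=(u_1,\ldots,u_N)^T\in\mathbb R^N$ let $G(\mathbf u)=\mathrm{diag}\big(\frac{\sin(2u_1)}{2u_1},\ldots,\frac{\sin(2u_N)}{2u_N}\big)$, with the convention that $\frac{\sin(2y)}{2y}=1$ at $y=0$. Let $M\in\mathbb N$ and $\Delta t=\frac TM$. The scheme is: $\mathbf u^0=(u_0(x_1),\ldots,u_0(x_N))^T$ and $$\frac{\mathbf u^{n+1}-\mathbf u^n}{\Delta t}=-C\mathbf u^{n+1}-G(\mathbf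 u^n)D^{-2}\mathbf u^{n+1},\qquad 0\le n\le M-1.$$ Norms and energy. For $\mathbf v\in\mathbb R^N$: $\|\mathbf v\|_\infty=\max_i|v_i|$ and $\|\mathbf v\|_{D,h}^2=h\sum_{i=1}^N x_i v_i^2$; $\langle\cdot,\cdot\rangle$ is the Euclidean scalar product on $\mathbb R^N$. $D^{-\alpha}=\mathrm{diag}(x_1^{-\alpha},\ldots,x_N^{-\alpha})$. The discrete Dirichlet energy is $$\mathcal E_h(\mathbf u)=h\langle DC\mathbf u,\mathbf u\rangle+h\langle D^{-1}F(\mathbf u),F(\mathbf u)\rangle,\qquad F(\mathbf u)=(\sin u_1,\ldots,\sin u_N)^T.$$ If $d_\alpha=0$, the time step condition in (a) is regarded as satisfied for every $\Delta t$. *)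

theory Defs
  imports "HOL-Analysis.Analysis" "Jordan_Normal_Form.Matrix"
begin

section \<open>Continuous problem\<close>

text \<open>
  Functions on $[0,1] \times [0,T]$ are total functions \<open>u x t\<close> of which only the values on the
  rectangle matter. Derivatives are taken within the rectangle, hence are one-sided on its boundary.
\<close>

primrec partial_x :: "nat \<Rightarrow> (real \<Rightarrow> real \<Rightarrow> real) \<Rightarrow> real \<Rightarrow> real \<Rightarrow> real" where
  "partial_x 0 u = u"
| "partial_x (Suc j) u = (\<lambda>x t. vector_derivative (\<lambda>y. partial_x j u y t) (at x within {0..1}))"

primrec partial_t :: "real \<Rightarrow> nat \<Rightarrow> (real \<Rightarrow> real \<Rightarrow> real) \<Rightarrow> real \<Rightarrow> real \<Rightarrow> real" where
  "partial_t T 0 u = u"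
| "partial_t T (Suc j) u = (\<lambda>x t. vector_derivative (\<lambda>s. partial_t T j u x s) (at t within {0..T}))"

definition sufficiently_smooth :: "real \<Rightarrow> (real \<Rightarrow> real \<Rightarrow> real) \<Rightarrow> bool" where
  "sufficiently_smooth T u \<longleftrightarrow>
     (\<forall>j<4. \<forall>x\<in>{0..1}. \<forall>t\<in>{0..T}. (\<lambda>y. partial_x j u y t) differentiable (at x within {0..1})) \<and>
     (\<forall>j<2. \<forall>x\<in>{0..1}. \<forall>t\<in>{0..T}. (\<lambda>s. partial_t T j u x s) differentiable (at t within {0..T})) \<and>
     (\<forall>j\<le>4. continuous_on ({0..1} \<times> {0..T}) (\<lambda>(x, t). partial_x j u x t)) \<and>
     (\<forall>j\<le>2. continuous_on ({0..1} \<times> {0..T}) (\<lambda>(x, t). partial_t T j u x t))"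

definition continuous_solution :: "real \<Rightarrow> (real \<Rightarrow> real) \<Rightarrow> (real \<Rightarrow> real \<Rightarrow> real) \<Rightarrow> bool" where
  "continuous_solution T u0 u \<longleftrightarrow>
     (\<forall>x\<in>{0<..1}. \<forall>t\<in>{0..T}.
        partial_t T 1 u x t =
          partial_x 2 u x t + 1 / x * partial_x 1 u x t - sin (2 * u x t) / (2 * x\<^sup>2)) \<and>
     (\<forall>x\<in>{0..1}. u x 0 = u0 x) \<and>
     (\<forall>t\<in>{0..T}. u 0 t = 0 \<and> u 1 t = 0)"

text \<open>Only applied to continuous functions, for which the supremum is the essential supremum.\<close>

definition Linf_norm :: "real \<Rightarrow> (real \<Rightarrow> real \<Rightarrow> real) \<Rightarrow> real" where
  "Linf_norm T w = (SUP (x, t)\<in>{0..1} \<times> {0..T}. \<bar>w x t\<bar>)"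


section \<open>Discretization\<close>

text \<open>Vectors and matrices are indexed from 0, so component \<open>i\<close> belongs to $x_{i+1}$.\<close>

definition mesh :: "nat \<Rightarrow> real" where
  "mesh N = 1 / (real N + 1)"

definition grid :: "nat \<Rightarrow> nat \<Rightarrow> real" where
  "grid N i = real i * mesh N"

definition tridiag :: "nat \<Rightarrow> real \<Rightarrow> real \<Rightarrow> real \<Rightarrow> real mat" where
  "tridiag N a b c =
     mat N N (\<lambda>(i, j). if i = j + 1 then a else if i = j then b else if j = i + 1 then c else 0)"

definition matA :: "nat \<Rightarrow> real mat" where
  "matA N = (1 / (mesh N)\<^sup>2) \<cdot>\<^sub>m tridiag N (-1) 2 (-1)"

definition matB :: "nat \<Rightarrow> real mat" where
  "matB N = (1 / (2 * mesh N)) \<cdot>\<^sub>m tridiag N (-1) 0 1"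

definition matD :: "nat \<Rightarrow> real mat" where
  "matD N = mat_diag N (\<lambda>i. grid N (i + 1))"

definition matD_powr :: "nat \<Rightarrow> real \<Rightarrow> real mat" where
  "matD_powr N a = mat_diag N (\<lambda>i. grid N (i + 1) powr a)"

definition matC :: "nat \<Rightarrow> real mat" where
  "matC N = matA N - matD_powr N (-1) * matB N"

definition matG :: "nat \<Rightarrow> real vec \<Rightarrow> real mat" where
  "matG N v = mat_diag N (\<lambda>i. if v $ i = 0 then 1 else sin (2 * (v $ i)) / (2 * (v $ i)))"

definition grid_values :: "nat \<Rightarrow> (real \<Rightarrow> real) \<Rightarrow> real vec" where
  "grid_values N f = vec N (\<lambda>i. f (grid N (i + 1)))"

definition discrete_solution ::
  "real \<Rightarrow> (real \<Rightarrow> real) \<Rightarrow> nat \<Rightarrow> nat \<Rightarrow> (nat \<Rightarrow> real vec) \<Rightarrow> bool" where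
  "discrete_solution T u0 N M U \<longleftrightarrow>
     (\<forall>n\<le>M. U n \<in> carrier_vec N) \<and>
     U 0 = grid_values N u0 \<and>
     (\<forall>n<M. (1 / (T / real M)) \<cdot>\<^sub>v (U (n + 1) - U n) =
        - (matC N *\<^sub>v U (n + 1)) - (matG N (U n) * matD_powr N (-2)) *\<^sub>v U (n + 1))"


section \<open>Norms and energy\<close>

definition max_norm :: "real vec \<Rightarrow> real" where
  "max_norm v = Max ((\<lambda>i. \<bar>v $ i\<bar>) ` {..<dim_vec v})"

definition Dh_norm :: "nat \<Rightarrow> real vec \<Rightarrow> real" where
  "Dh_norm N v = sqrt (mesh N * (\<Sum>i<N. grid N (i + 1) * (v $ i)\<^sup>2))"

definition energy :: "nat \<Rightarrow> real vec \<Rightarrow> real" where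
  "energy N v =
     mesh N * scalar_prod ((matD N * matC N) *\<^sub>v v) v +
     mesh N * scalar_prod (matD_powr N (-1) *\<^sub>v map_vec sin v) (map_vec sin v)"

end

theory Submission
  imports Defs
begin

text \<open>
  By the discrete maximum principle all iterates stay in $[-\pi/4, \pi/4]$, where
  $g(u) = \sin(2u)/(2u) \ge 1/2$. Testing the scheme with $D(u^{n+1} - u^n)$, the nonlinear part
  of the energy contributes $\sin^2 v - \sin^2 u - 2 g(u) v (v - u) \le (1 - 2 g(u)) (v - u)^2 \le 0$
  for $u = u^n_i$ and $v = u^{n+1}_i$, so the energy decreases for every time step, and both energy
  estimates follow.

  For the error estimate, the equation for the error $e^{n+1}$ is tested with $D e^{n+1}$. The
  term $g(u^n) D^{-1} e^{n+1}$ then controls $D^{-1} e^{n+1} \cdot e^{n+1}$, which absorbs the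
  consistency errors: all of them, the error in $g$ included because
  $|u(x, t)| \le x \|u_x\|_\infty$, have size $(\kappa |e^n| + R) / x$ with
  $R = O(\Delta t + h^2)$. The resulting recursion is summed as usual and even gives the order
  $\Delta t + h^2$.
\<close>

section \<open>The nonlinearity\<close>

text \<open>The diagonal entry of \<open>matG\<close> as a function of the nodal value.\<close>

definition sin_quot :: "real \<Rightarrow> real" where
  "sin_quot y = (if y = 0 then 1 else sin (2 * y) / (2 * y))"

lemma sin_quot_mult: "2 * (sin_quot y * y) = sin (2 * y)"
  by (simp add: sin_quot_def)

lemma sin_quot_minus [simp]: "sin_quot (- y) = sin_quot y"
  by (simp add: sin_quot_def)

text \<open>A crude form of Jordan's inequality. It follows from y * cos y \<le> sin y at y = z / 2
  and the double angle formulas.\<close>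

lemma half_le_sin:
  fixes z :: real
  assumes "0 \<le> z" "z \<le> pi / 2"
  shows "z / 2 \<le> sin z"
proof -
  have le: "y * cos y \<le> sin y" if "0 \<le> y" "y \<le> pi" for y :: real
  proof -
    \<comment> \<open>The derivative of sin y - y * cos y is y * sin y, which is nonnegative on the
      interval from 0 to pi.\<close>
    have "sin 0 - 0 * cos 0 \<le> sin y - y * cos y"
    proof (rule DERIV_nonneg_imp_nondecreasing[where f = "\<lambda>y. sin y - y * cos y"])
      fix x :: real assume "0 \<le> x" "x \<le> y"
      then show "\<exists>D. ((\<lambda>y. sin y - y * cos y) has_real_derivative D) (at x) \<and> 0 \<le> D"
        using that by (intro exI[of _ "x * sin x"])
          (auto intro!: derivative_eq_intros mult_nonneg_nonneg sin_ge_zero)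
    qed (use that in auto)
    then show ?thesis by simp
  qed
  have c: "0 \<le> cos z" "0 \<le> cos (z / 2)"
    using assms by (auto intro!: cos_ge_zero)
  \<comment> \<open>Uses cos z \<ge> 0; the factor (1 + cos z) / 2 is the square of cos (z /
    2).\<close>
  have "z / 2 \<le> z * ((1 + cos z) / 2)"
    using assms(1) c(1) by (simp add: distrib_left mult.commute)
  also have "\<dots> = 2 * (z / 2 * cos (z / 2)) * cos (z / 2)"
    using cos_double_cos[of "z / 2"] by (simp add: power2_eq_square)
  also have "\<dots> \<le> 2 * sin (z / 2) * cos (z / 2)"
    using le[of "z / 2"] assms c(2) by (intro mult_right_mono mult_left_mono) auto
  also have "\<dots> = sin z"
    using sin_double[of "z / 2"] by simp
  finally show ?thesis .
qed

text \<open>The value 1/2 is the threshold of both main arguments: it gives 1 - 2 *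
  \<open>sin_quot y\<close> \<le> 0 in the energy estimate and the term b^2 / (2 x) that absorbs the
  residual in the error estimate. By evenness only y \<ge> 0 has to be treated.\<close>

lemma sin_quot_ge_half:
  assumes "\<bar>y\<bar> \<le> pi / 4"
  shows "1 / 2 \<le> sin_quot y"
proof -
  have *: "1 / 2 \<le> sin_quot y" if "0 \<le> y" "y \<le> pi / 4" for y
    using half_le_sin[of "2 * y"] that by (simp add: sin_quot_def field_simps)
  show ?thesis
    using *[of y] *[of "- y"] assms by (cases "0 \<le> y") auto
qed

text \<open>\<open>sin_quot a\<close> is the integral of cos (2 a s) over s from 0 to 1, and the
  integrands for a and b differ by at most 2 * \<bar>a - b\<bar>.\<close>

lemma sin_quot_lipschitz: "\<bar>sin_quot a - sin_quot b\<bar> \<le> 2 * \<bar>a - b\<bar>"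
proof -
  \<comment> \<open>\<open>\<phi> a\<close> is the primitive of cos (2 a s) that vanishes at s = 0,
    and its value at s = 1 is \<open>sin_quot a\<close>, also for a = 0. The mean value inequality
    for \<open>\<phi> a - \<phi> b\<close> takes the place of integration.\<close>
  define \<phi> where "\<phi> = (\<lambda>(a::real) (s::real). if a = 0 then s else sin (2 * a * s) / (2 * a))"
  have \<phi>: "(\<phi> a has_field_derivative cos (2 * a * s)) (at s within {0..1})" for a s
    unfolding \<phi>_def by (cases "a = 0") (auto intro!: derivative_eq_intros)
  have "norm ((\<phi> a 1 - \<phi> b 1) - (\<phi> a 0 - \<phi> b 0)) \<le> (2 * \<bar>a - b\<bar>) * norm (1 - 0 :: real)"
  proof (rule field_differentiable_bound[of "{0..1}"])
    fix s :: real assume s: "s \<in> {0..1}"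
    show "((\<lambda>s. \<phi> a s - \<phi> b s) has_field_derivative cos (2 * a * s) - cos (2 * b * s))
            (at s within {0..1})"
      by (intro DERIV_diff \<phi>)
    have "\<bar>cos (2 * a * s) - cos (2 * b * s)\<bar> \<le> 1 * \<bar>2 * a * s - 2 * b * s\<bar>"
      using field_differentiable_bound[of UNIV cos "\<lambda>x. - sin x" 1 "2 * a * s" "2 * b * s"]
      by (auto intro!: derivative_eq_intros)
    also have "\<dots> = 2 * \<bar>a - b\<bar> * s"
    proof -
      have "1 * \<bar>2 * a * s - 2 * b * s\<bar> = \<bar>2 * (a - b) * s\<bar>" by (simp add: algebra_simps)
      also have "\<dots> = 2 * \<bar>a - b\<bar> * s" using s by (simp only: abs_mult) simp
      finally show ?thesis .
    qed
    also have "\<dots> \<le> 2 * \<bar>a - b\<bar>"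
      using s by (intro mult_left_le) auto
    finally show "norm (cos (2 * a * s) - cos (2 * b * s)) \<le> 2 * \<bar>a - b\<bar>" by simp
  qed auto
  then show ?thesis
    by (cases "a = 0"; cases "b = 0") (simp_all add: \<phi>_def sin_quot_def)
qed

text \<open>The function y^2 - sin(y)^2 is convex, its second derivative being 2 - 2 cos (2 y). The
  claim is its tangent inequality at x, rearranged.\<close>

lemma sin_squared_diff_le:
  fixes x y :: real
  shows "(sin y)\<^sup>2 - (sin x)\<^sup>2 \<le> sin (2 * x) * (y - x) + (y - x)\<^sup>2"
proof -
  have deriv: "((\<lambda>y :: real. y\<^sup>2 - (sin y)\<^sup>2) has_real_derivative 2 * y - sin (2 * y)) (at y)" for y
    by (rule derivative_eq_intros refl | simp add: sin_double)+
  have deriv': "((\<lambda>y :: real. 2 * y - sin (2 * y)) has_real_derivative 2 - 2 * cos (2 * y)) (at y)" for y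
    by (rule derivative_eq_intros refl | simp)+
  have "convex_on UNIV (\<lambda>y :: real. y\<^sup>2 - (sin y)\<^sup>2)"
    by (rule f''_ge0_imp_convex[OF _ deriv deriv']) auto
  then have "(2 * x - sin (2 * x)) * (y - x) \<le> (y\<^sup>2 - (sin y)\<^sup>2) - (x\<^sup>2 - (sin x)\<^sup>2)"
    by (rule convex_on_imp_above_tangent[OF _ _ _ _ deriv]) auto
  then show ?thesis by (simp add: power2_eq_square algebra_simps)
qed

section \<open>The scheme on the grid\<close>

lemma mesh_pos [simp]: "0 < mesh N" and mesh_nonneg [simp]: "0 \<le> mesh N"
  and mesh_nonzero [simp]: "mesh N \<noteq> 0"
  by (simp_all add: mesh_def add_pos_nonneg)

lemma grid_pos: "0 < i \<Longrightarrow> 0 < grid N i"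
  by (simp add: grid_def)

lemma grid_bounds:
  assumes "i \<le> Suc N" shows "grid N i \<in> {0..1}"
  using assms by (auto simp: grid_def mesh_def field_simps)

text \<open>Shifts the index to that of the grid and adds the boundary values.\<close>

definition ext :: "real vec \<Rightarrow> nat \<Rightarrow> real" where
  "ext v i = (if 1 \<le> i \<and> i \<le> dim_vec v then v $ (i - 1) else 0)"

text \<open>The stencil of \<open>matC\<close> on grid functions that include the boundary nodes, so
  that it also applies to samples of the continuous solution. It is meaningful for indices from 1 to
  N; as \<open>matC\<close> has the sign of A, it approximates -u_xx - u_x / x.\<close>

definition diff_op :: "nat \<Rightarrow> (nat \<Rightarrow> real) \<Rightarrow> nat \<Rightarrow> real" where
  "diff_op N v i = (2 * v i - v (i - 1) - v (i + 1)) / (mesh N)\<^sup>2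
     - (v (i + 1) - v (i - 1)) / (2 * mesh N * grid N i)"

lemma ext_0 [simp]: "ext v 0 = 0" and ext_Suc_dim: "v \<in> carrier_vec N \<Longrightarrow> ext v (Suc N) = 0"
  and ext_Suc: "v \<in> carrier_vec N \<Longrightarrow> i < N \<Longrightarrow> ext v (Suc i) = v $ i"
  by (auto simp: ext_def)

text \<open>Row \<open>i\<close> belongs to node \<open>Suc i\<close>, which explains the shifted
  arguments of \<open>V\<close>. The entries missing in the first and last row are supplied by the
  zero boundary values.\<close>

lemma sum_tridiag:
  fixes V :: "nat \<Rightarrow> real"
  assumes "i < N" "V 0 = 0" "V (Suc N) = 0"
  shows "(\<Sum>j<N. tridiag N a b c $$ (i, j) * V (Suc j)) = a * V i + b * V (Suc i) + c * V (Suc (Suc i))"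
proof -
  have "(\<Sum>j<N. tridiag N a b c $$ (i, j) * V (Suc j)) =
      (\<Sum>j<N. if Suc j = i then a * V i else 0) + (\<Sum>j<N. if j = i then b * V (Suc i) else 0)
      + (\<Sum>j<N. if j = Suc i then c * V (Suc (Suc i)) else 0)"
    unfolding sum.distrib[symmetric]
    by (rule sum.cong) (use assms(1) in \<open>auto simp: tridiag_def\<close>)
  also have "(\<Sum>j<N. if Suc j = i then a * V i else 0) = a * V i"
    using assms by (cases i) auto
  also have "(\<Sum>j<N. if j = Suc i then c * V (Suc (Suc i)) else 0) = c * V (Suc (Suc i))"
  proof (cases "Suc i = N")
    case True
    then show ?thesis using assms by auto
  next
    case False
    then show ?thesis using assms by simp
  qed
  finally show ?thesis using assms(1) by simp
qed

lemma mat_diag_carrier: "mat_diag n f \<in> carrier_mat n n"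
  by (simp add: mat_diag_def)

lemma mat_diag_mult_vec:
  fixes v :: "'a :: comm_semiring_1 vec"
  assumes "v \<in> carrier_vec n" "i < n"
  shows "(mat_diag n f *\<^sub>v v) $ i = f i * v $ i"
proof -
  have "(mat_diag n f *\<^sub>v v) $ i = (\<Sum>j<n. mat_diag n f $$ (i, j) * v $ j)"
    using assms by (auto simp: mat_diag_def scalar_prod_def atLeast0LessThan intro!: sum.cong)
  also have "\<dots> = (\<Sum>j<n. if j = i then f i * v $ i else 0)"
    using assms by (intro sum.cong) (auto simp: mat_diag_def)
  finally show ?thesis using assms(2) by simp
qed

lemma matC_carrier: "matC N \<in> carrier_mat N N"
  unfolding matC_def matA_def matB_def matD_powr_def tridiag_def
  by (intro minus_carrier_mat mult_carrier_mat[OF mat_diag_carrier]) simp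

lemma matC_index:
  assumes "i < N" "j < N"
  shows "matC N $$ (i, j) = tridiag N (-1) 2 (-1) $$ (i, j) / (mesh N)\<^sup>2
    - tridiag N (-1) 0 1 $$ (i, j) / (2 * mesh N * grid N (Suc i))"
proof -
  have B: "matB N \<in> carrier_mat N N" by (simp add: matB_def tridiag_def)
  have "grid N (Suc i) powr (-1) = 1 / grid N (Suc i)"
    by (simp add: powr_minus_divide grid_pos less_imp_le)
  then show ?thesis
    using assms by (simp add: matC_def matD_powr_def mat_diag_mult_left[OF B])
      (simp add: matA_def matB_def tridiag_def)
qed

lemma matC_mult_vec:
  assumes "v \<in> carrier_vec N" "i < N"
  shows "(matC N *\<^sub>v v) $ i = diff_op N (ext v) (Suc i)"
proof -
  have "(matC N *\<^sub>v v) $ i = (\<Sum>j<N. matC N $$ (i, j) * ext v (Suc j))"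
    using assms matC_carrier[of N]
    by (auto simp: scalar_prod_def ext_Suc atLeast0LessThan intro!: sum.cong)
  also have "\<dots> = (\<Sum>j<N. tridiag N (-1) 2 (-1) $$ (i, j) * ext v (Suc j)) / (mesh N)\<^sup>2
      - (\<Sum>j<N. tridiag N (-1) 0 1 $$ (i, j) * ext v (Suc j)) / (2 * mesh N * grid N (Suc i))"
    using assms(2) by (simp add: matC_index left_diff_distrib sum_subtractf sum_divide_distrib)
  also have "\<dots> = diff_op N (ext v) (Suc i)"
    using assms by (simp add: sum_tridiag ext_Suc_dim diff_op_def)
  finally show ?thesis .
qed

text \<open>Together with \<open>energy_ext\<close> and \<open>Dh_norm_squared\<close> this is the
  passage from matrices to scalar equations and sums over the interior nodes.\<close>

lemma discrete_solution_pointwise: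
  assumes "discrete_solution T u0 N M U" "n < M" "i \<in> {1..N}"
  shows "(ext (U (Suc n)) i - ext (U n) i) / (T / real M) = - diff_op N (ext (U (Suc n))) i
     - sin_quot (ext (U n) i) * ext (U (Suc n)) i / (grid N i)\<^sup>2"
proof -
  obtain k where k: "i = Suc k" "k < N" using assms(3) by (cases i) auto
  have U: "U n \<in> carrier_vec N" "U (Suc n) \<in> carrier_vec N"
    using assms(1,2) by (auto simp: discrete_solution_def)
  have eq: "(1 / (T / real M)) \<cdot>\<^sub>v (U (Suc n) - U n) =
        - (matC N *\<^sub>v U (Suc n)) - (matG N (U n) * matD_powr N (-2)) *\<^sub>v U (Suc n)"
    using assms(1,2) by (auto simp: discrete_solution_def)
  have p: "grid N (Suc k) powr (-2) = 1 / (grid N (Suc k))\<^sup>2"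
    using grid_pos[of "Suc k" N] by (simp add: powr_minus_divide)
  have G: "((matG N (U n) * matD_powr N (-2)) *\<^sub>v U (Suc n)) $ k
      = sin_quot (U n $ k) * U (Suc n) $ k / (grid N (Suc k))\<^sup>2"
    unfolding matG_def matD_powr_def mat_diag_diag mat_diag_mult_vec[OF U(2) k(2)]
    using p by (simp add: sin_quot_def)
  have "((1 / (T / real M)) \<cdot>\<^sub>v (U (Suc n) - U n)) $ k = (U (Suc n) $ k - U n $ k) / (T / real M)"
    using k(2) U by simp
  moreover have "(- (matC N *\<^sub>v U (Suc n)) - (matG N (U n) * matD_powr N (-2)) *\<^sub>v U (Suc n)) $ k
     = - ((matC N *\<^sub>v U (Suc n)) $ k) - ((matG N (U n) * matD_powr N (-2)) *\<^sub>v U (Suc n)) $ k"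
    using k(2) matC_carrier[of N] by (simp add: matG_def matD_powr_def mat_diag_def)
  ultimately show ?thesis
    using eq G matC_mult_vec[OF U(2) k(2)] ext_Suc[OF U(1) k(2)] ext_Suc[OF U(2) k(2)] k(1)
    by (simp del: index_mult_mat_vec)
qed

lemma energy_ext:
  assumes "v \<in> carrier_vec N"
  shows "energy N v = mesh N * (\<Sum>i=1..N. grid N i * diff_op N (ext v) i * ext v i)
     + mesh N * (\<Sum>i=1..N. (sin (ext v i))\<^sup>2 / grid N i)"
proof -
  have C: "((matD N * matC N) *\<^sub>v v) $ i = grid N (Suc i) * diff_op N (ext v) (Suc i)" if "i < N" for i
  proof -
    have "((matD N * matC N) *\<^sub>v v) $ i = (\<Sum>j<N. grid N (Suc i) * matC N $$ (i, j) * v $ j)"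
      using that assms unfolding matD_def mat_diag_mult_left[OF matC_carrier]
      by (auto simp: scalar_prod_def atLeast0LessThan intro!: sum.cong)
    also have "\<dots> = grid N (Suc i) * (matC N *\<^sub>v v) $ i"
      using that assms matC_carrier[of N]
      by (auto simp: scalar_prod_def atLeast0LessThan sum_distrib_left mult.assoc intro!: sum.cong)
    finally show ?thesis using matC_mult_vec[OF assms that] by simp
  qed
  have F: "(matD_powr N (-1) *\<^sub>v map_vec sin v) $ i = sin (v $ i) / grid N (Suc i)" if "i < N" for i
    unfolding matD_powr_def using that assms
    by (subst mat_diag_mult_vec) (auto simp: powr_minus_divide grid_pos less_imp_le)
  have "scalar_prod ((matD N * matC N) *\<^sub>v v) v = (\<Sum>i=1..N. grid N i * diff_op N (ext v) i * ext v i)"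
    using assms C unfolding scalar_prod_def
    by (auto simp: sum.atLeast1_atMost_eq ext_Suc atLeast0LessThan simp del: index_mult_mat_vec intro!: sum.cong)
  moreover have "scalar_prod (matD_powr N (-1) *\<^sub>v map_vec sin v) (map_vec sin v)
      = (\<Sum>i=1..N. (sin (ext v i))\<^sup>2 / grid N i)"
    using assms F unfolding scalar_prod_def
    by (auto simp: sum.atLeast1_atMost_eq ext_Suc atLeast0LessThan power2_eq_square
        simp del: index_mult_mat_vec intro!: sum.cong)
  ultimately show ?thesis by (simp add: energy_def)
qed

lemma Dh_norm_squared:
  assumes "v \<in> carrier_vec N"
  shows "(Dh_norm N v)\<^sup>2 = mesh N * (\<Sum>i=1..N. grid N i * (ext v i)\<^sup>2)"
proof -
  have "(\<Sum>i<N. grid N (i + 1) * (v $ i)\<^sup>2) = (\<Sum>i=1..N. grid N i * (ext v i)\<^sup>2)"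
    using assms by (auto simp: sum.atLeast1_atMost_eq ext_Suc intro!: sum.cong)
  moreover have "0 \<le> (\<Sum>i=1..N. grid N i * (ext v i)\<^sup>2)"
    by (intro sum_nonneg) (auto simp: grid_def)
  ultimately show ?thesis by (simp add: Dh_norm_def)
qed

section \<open>Energy and maximum principle\<close>

text \<open>Up to a factor h, the discretization of the integral of x * v_x * w_x; the weight x_i +
  h / 2 is the midpoint of the cell.\<close>

definition dirichlet_form :: "nat \<Rightarrow> (nat \<Rightarrow> real) \<Rightarrow> (nat \<Rightarrow> real) \<Rightarrow> real" where
  "dirichlet_form N v w =
     (\<Sum>i\<le>N. (grid N i + mesh N / 2) / (mesh N)\<^sup>2 * (v (Suc i) - v i) * (w (Suc i) - w i))"

lemma sum_by_parts:
  fixes q w :: "nat \<Rightarrow> real"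
  assumes "w 0 = 0" "w (Suc N) = 0"
  shows "(\<Sum>i=1..N. (q (i - 1) - q i) * w i) = (\<Sum>i\<le>N. q i * (w (Suc i) - w i))"
proof -
  \<comment> \<open>Induction requires keeping the boundary term at n, which vanishes for n = N; the
    one at 0 vanishes because of \<open>w 0 = 0\<close>.\<close>
  have "(\<Sum>i=1..n. (q (i - 1) - q i) * w i) = (\<Sum>i\<le>n. q i * (w (Suc i) - w i)) - q n * w (Suc n)" for n
    using assms(1) by (induction n) (simp_all add: algebra_simps)
  then show ?thesis using assms(2) by simp
qed

text \<open>Multiplication by x brings the operator into conservative form, the discrete -(x v_x)_x,
  so summation by parts applies. This is why equations are tested with the weight x.\<close>

lemma sum_diff_op:
  assumes "w 0 = 0" "w (Suc N) = 0"
  shows "(\<Sum>i=1..N. grid N i * diff_op N v i * w i) = dirichlet_form N v w"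
proof -
  \<comment> \<open>The flux x v_x at the midpoint between nodes i and i + 1, divided by h.\<close>
  define q where "q i = (grid N i + mesh N / 2) / (mesh N)\<^sup>2 * (v (Suc i) - v i)" for i
  have "grid N i * diff_op N v i = q (i - 1) - q i" if "i \<in> {1..N}" for i
  proof -
    obtain k where k: "i = Suc k" using \<open>i \<in> {1..N}\<close> by (cases i) auto
    have g: "grid N k = grid N (Suc k) - mesh N"
      by (simp add: grid_def algebra_simps)
    have "grid N (Suc k) \<noteq> 0" using grid_pos[of "Suc k" N] by simp
    then show ?thesis
      by (simp add: k q_def diff_op_def g field_simps power2_eq_square)
  qed
  then show ?thesis
    using sum_by_parts[of w N q, OF assms] by (simp add: dirichlet_form_def q_def)
qed

lemma dirichlet_form_nonneg: "0 \<le> dirichlet_form N v v"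
  unfolding dirichlet_form_def
  by (intro sum_nonneg) (simp add: mult.assoc grid_def)

text \<open>The identity B(v,v) - B(u,u) = 2 B(v,v-u) - B(v-u,v-u) of a symmetric bilinear form,
  checked summand by summand.\<close>

lemma dirichlet_form_diff:
  "dirichlet_form N v v - dirichlet_form N u u
     = 2 * dirichlet_form N v (\<lambda>i. v i - u i) - dirichlet_form N (\<lambda>i. v i - u i) (\<lambda>i. v i - u i)"
proof -
  have *: "c * (p - q) * (p - q) - c * (r - s) * (r - s)
      = 2 * (c * (p - q) * ((p - r) - (q - s))) - c * ((p - r) - (q - s)) * ((p - r) - (q - s))"
    for c p q r s :: real by (simp add: algebra_simps)
  show ?thesis
    unfolding dirichlet_form_def sum_subtractf[symmetric] sum_distrib_left
    by (intro sum.cong refl *)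
qed

lemma energy_decreasing:
  assumes u: "u \<in> carrier_vec N" "\<And>i. i \<in> {1..N} \<Longrightarrow> \<bar>ext u i\<bar> \<le> pi / 4"
    and v: "v \<in> carrier_vec N" and k: "0 < k"
    and step: "\<And>i. i \<in> {1..N} \<Longrightarrow> (ext v i - ext u i) / k
        = - diff_op N (ext v) i - sin_quot (ext u i) * ext v i / (grid N i)\<^sup>2"
  shows "energy N v \<le> energy N u"
proof -
  define w where "w i = ext v i - ext u i" for i
  have w: "w 0 = 0" "w (Suc N) = 0"
    using u v by (auto simp: w_def ext_Suc_dim)
  \<comment> \<open>This nodal inequality suffices: its first term sums to twice
    \<open>dirichlet_form N (ext v) w\<close>, which by \<open>dirichlet_form_diff\<close> is at
    least the increase of the quadratic part of the energy.\<close>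
  have "2 * (grid N i * diff_op N (ext v) i * w i)
      + ((sin (ext v i))\<^sup>2 / grid N i - (sin (ext u i))\<^sup>2 / grid N i) \<le> 0"
    if i: "i \<in> {1..N}" for i
  proof -
    define x g a b where "x = grid N i" and "g = sin_quot (ext u i)" and "a = ext u i" and "b = ext v i"
    have x: "0 < x" using i by (simp add: x_def grid_pos)
    have g: "1 / 2 \<le> g" unfolding g_def by (rule sin_quot_ge_half[OF u(2)[OF i]])
    have *: "diff_op N (ext v) i = - (w i / k) - g * b / x\<^sup>2"
      using step[OF i] by (simp add: w_def x_def g_def b_def)
    have "2 * (x * diff_op N (ext v) i * w i) + ((sin b)\<^sup>2 / x - (sin a)\<^sup>2 / x)
        = - (2 * x * (w i)\<^sup>2 / k) + ((sin b)\<^sup>2 - (sin a)\<^sup>2 - 2 * g * b * w i) / x"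
      using x k by (simp add: * field_simps power2_eq_square)
    also have "(sin b)\<^sup>2 - (sin a)\<^sup>2 - 2 * g * b * w i \<le> 0"
    proof -
      \<comment> \<open>Writing b = a + w turns 2 g a into sin (2 a), the slope in
        \<open>sin_squared_diff_le\<close>; the remaining 2 g w^2 dominates w^2 because 2 g \<ge>
        1.\<close>
      have "2 * g * b * w i = 2 * g * (w i)\<^sup>2 + 2 * (g * a) * w i"
        by (simp add: w_def a_def b_def power2_eq_square algebra_simps)
      then have "2 * g * b * w i = 2 * g * (w i)\<^sup>2 + sin (2 * a) * w i"
        by (simp add: g_def a_def sin_quot_mult)
      moreover have "(w i)\<^sup>2 \<le> 2 * g * (w i)\<^sup>2"
        using g mult_right_mono[of 1 "2 * g" "(w i)\<^sup>2"] by simp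
      ultimately show ?thesis
        using sin_squared_diff_le[of b a] by (simp add: w_def a_def b_def)
    qed
    then have "((sin b)\<^sup>2 - (sin a)\<^sup>2 - 2 * g * b * w i) / x \<le> 0"
      using x by (simp add: divide_nonpos_pos)
    moreover have "0 \<le> 2 * x * (w i)\<^sup>2 / k" using x k by simp
    ultimately show ?thesis unfolding x_def a_def b_def by linarith
  qed
  then have "(\<Sum>i=1..N. 2 * (grid N i * diff_op N (ext v) i * w i)
      + ((sin (ext v i))\<^sup>2 / grid N i - (sin (ext u i))\<^sup>2 / grid N i)) \<le> 0"
    by (intro sum_nonpos) auto
  then have "2 * dirichlet_form N (ext v) w
      + ((\<Sum>i=1..N. (sin (ext v i))\<^sup>2 / grid N i) - (\<Sum>i=1..N. (sin (ext u i))\<^sup>2 / grid N i)) \<le> 0"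
    by (simp add: sum.distrib sum_subtractf flip: sum_distrib_left sum_diff_op[OF w])
  then have "dirichlet_form N (ext v) (ext v) + (\<Sum>i=1..N. (sin (ext v i))\<^sup>2 / grid N i)
      \<le> dirichlet_form N (ext u) (ext u) + (\<Sum>i=1..N. (sin (ext u i))\<^sup>2 / grid N i)"
    using dirichlet_form_diff[of N "ext v" "ext u"] dirichlet_form_nonneg[of N w]
    by (simp add: w_def[abs_def])
  then have "mesh N * (dirichlet_form N (ext v) (ext v) + (\<Sum>i=1..N. (sin (ext v i))\<^sup>2 / grid N i))
      \<le> mesh N * (dirichlet_form N (ext u) (ext u) + (\<Sum>i=1..N. (sin (ext u i))\<^sup>2 / grid N i))"
    by (rule mult_left_mono) simp
  then show ?thesis
    unfolding energy_ext[OF u(1)] energy_ext[OF v] sum_diff_op[OF ext_0 ext_Suc_dim[OF u(1)]]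
      sum_diff_op[OF ext_0 ext_Suc_dim[OF v]] by (simp only: distrib_left)
qed

section \<open>Discrete maximum principle\<close>

text \<open>At a node where \<bar>v\<bar> is maximal, the implicit equation expresses v through u
  and the two neighbours with nonnegative weights. The neighbours contribute at most 2 r
  \<bar>v\<bar>, which the left-hand side outweighs.\<close>

lemma step_max_bound:
  assumes u: "\<And>i. i \<in> {1..N} \<Longrightarrow> \<bar>u i\<bar> \<le> b"
    and v: "v 0 = 0" "v (Suc N) = 0" and k: "0 < k"
    and g: "\<And>i. i \<in> {1..N} \<Longrightarrow> 0 \<le> g i"
    and step: "\<And>i. i \<in> {1..N} \<Longrightarrow> (v i - u i) / k = - diff_op N v i - g i * v i / (grid N i)\<^sup>2"
    and "i \<in> {1..N}"
  shows "\<bar>v i\<bar> \<le> b"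
proof -
  have fin: "finite ((\<lambda>i. \<bar>v i\<bar>) ` {1..N})" by simp
  have "Max ((\<lambda>i. \<bar>v i\<bar>) ` {1..N}) \<in> (\<lambda>i. \<bar>v i\<bar>) ` {1..N}"
    using assms(7) by (intro Max_in) auto
  then obtain m where m: "m \<in> {1..N}" "Max ((\<lambda>i. \<bar>v i\<bar>) ` {1..N}) = \<bar>v m\<bar>" by auto
  have max: "\<bar>v j\<bar> \<le> \<bar>v m\<bar>" if "j \<le> Suc N" for j
  proof (cases "j \<in> {1..N}")
    case True
    then show ?thesis using Max_ge[OF fin imageI[of j]] unfolding m(2) by blast
  next
    case False
    then have "j = 0 \<or> j = Suc N" using that by auto
    then show ?thesis using v by auto
  qed
  \<comment> \<open>Since x = m h, the first-order term becomes r times the difference of the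
    neighbours times h / (2 x) = 1 / (2 m). As this s is at most 1, the neighbour weights 1 - s and
    1 + s are nonnegative; they add up to 2.\<close>
  define x r s where "x = grid N m" and "r = k / (mesh N)\<^sup>2" and "s = 1 / (2 * real m)"
  have x: "0 < x" "x = real m * mesh N" using m(1) by (auto simp: x_def grid_pos grid_def)
  have r: "0 \<le> r" and s: "0 \<le> s" "s \<le> 1" using k m(1) by (auto simp: r_def s_def)
  have "k * diff_op N v m = r * (2 * v m - (1 - s) * v (m - 1) - (1 + s) * v (m + 1))"
    using m(1) by (simp add: diff_op_def x_def[symmetric] x(2) r_def s_def field_simps power2_eq_square)
  moreover have "v m - u m = k * (- diff_op N v m - g m * v m / x\<^sup>2)"
    using step[OF m(1)] k by (simp add: x_def field_simps)
  ultimately have "v m * (1 + 2 * r + k * g m / x\<^sup>2) = u m + r * ((1 - s) * v (m - 1) + (1 + s) * v (m + 1))"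
    by (simp add: algebra_simps)
  then have "\<bar>v m\<bar> * \<bar>1 + 2 * r + k * g m / x\<^sup>2\<bar> = \<bar>u m + r * ((1 - s) * v (m - 1) + (1 + s) * v (m + 1))\<bar>"
    by (metis abs_mult)
  also have "\<dots> \<le> \<bar>u m\<bar> + r * ((1 - s) * \<bar>v (m - 1)\<bar> + (1 + s) * \<bar>v (m + 1)\<bar>)"
  proof -
    have "\<bar>(1 - s) * v (m - 1) + (1 + s) * v (m + 1)\<bar> \<le> (1 - s) * \<bar>v (m - 1)\<bar> + (1 + s) * \<bar>v (m + 1)\<bar>"
      using s abs_triangle_ineq[of "(1 - s) * v (m - 1)" "(1 + s) * v (m + 1)"] by (simp add: abs_mult)
    then have "\<bar>r * ((1 - s) * v (m - 1) + (1 + s) * v (m + 1))\<bar> \<le> r * ((1 - s) * \<bar>v (m - 1)\<bar> + (1 + s) * \<bar>v (m + 1)\<bar>)"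
      using r by (simp add: abs_mult mult_left_mono)
    then show ?thesis using abs_triangle_ineq[of "u m" "r * ((1 - s) * v (m - 1) + (1 + s) * v (m + 1))"] by linarith
  qed
  also have "\<dots> \<le> \<bar>u m\<bar> + r * ((1 - s) * \<bar>v m\<bar> + (1 + s) * \<bar>v m\<bar>)"
    using r s m(1) by (intro add_left_mono mult_left_mono add_mono max) auto
  finally have "\<bar>v m\<bar> * \<bar>1 + 2 * r + k * g m / x\<^sup>2\<bar> \<le> \<bar>u m\<bar> + \<bar>v m\<bar> * (2 * r)"
    by (simp add: algebra_simps)
  moreover have "\<bar>v m\<bar> * (1 + 2 * r) \<le> \<bar>v m\<bar> * \<bar>1 + 2 * r + k * g m / x\<^sup>2\<bar>"
    using r k g[OF m(1)] by (intro mult_left_mono) (auto simp: abs_of_nonneg)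
  ultimately have "\<bar>v m\<bar> \<le> \<bar>u m\<bar>" by (simp add: distrib_left)
  then show ?thesis using u[OF m(1)] max[of i] assms(7) by fastforce
qed

text \<open>The bound at time n makes \<open>sin_quot\<close> positive there, which is the sign
  condition that \<open>step_max_bound\<close> needs for time n + 1.\<close>

lemma discrete_solution_bounded:
  assumes sol: "discrete_solution T u0 N M U" and "0 < T" "1 \<le> N" "1 \<le> M"
    and init: "max_norm (U 0) \<le> pi / 4" and n: "n \<le> M" and "i \<in> {1..N}"
  shows "\<bar>ext (U n) i\<bar> \<le> pi / 4"
  using n \<open>i \<in> {1..N}\<close>
proof (induction n arbitrary: i)
  case 0
  have U: "U 0 \<in> carrier_vec N" using sol unfolding discrete_solution_def by blast
  have "\<bar>U 0 $ j\<bar> \<le> pi / 4" if "j < N" for j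
  proof -
    have "\<bar>U 0 $ j\<bar> \<le> max_norm (U 0)"
      unfolding max_norm_def using that U by (intro Max_ge) auto
    then show ?thesis using init by simp
  qed
  moreover have "i - 1 < N" "ext (U 0) i = U 0 $ (i - 1)" using 0(2) U by (auto simp: ext_def)
  ultimately show ?case by simp
next
  case (Suc n)
  have U: "U (Suc n) \<in> carrier_vec N" using sol Suc.prems(1) by (simp add: discrete_solution_def)
  show ?case
  proof (rule step_max_bound[where u = "ext (U n)" and k = "T / real M" and g = "\<lambda>i. sin_quot (ext (U n) i)"])
    show "0 \<le> sin_quot (ext (U n) j)" if "j \<in> {1..N}" for j
      using sin_quot_ge_half[OF Suc.IH[of j]] Suc.prems(1) that by simp
  qed (use Suc U assms discrete_solution_pointwise[OF sol] in \<open>auto simp: ext_Suc_dim\<close>)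
qed

section \<open>Error estimate\<close>

text \<open>Testing with x e' yields the damping term \<gamma> e'^2 / x. Half of e'^2 / x absorbs
  the residual although that is singular like 1 / x, and what Young's inequality leaves over carries
  the weight x of the norm.\<close>

lemma error_step:
  assumes e': "e' 0 = 0" "e' (Suc N) = 0" and k: "0 < k" and \<kappa>: "0 \<le> \<kappa>" and R: "0 \<le> R"
    and \<gamma>: "\<And>i. i \<in> {1..N} \<Longrightarrow> 1 / 2 \<le> \<gamma> i"
    and step: "\<And>i. i \<in> {1..N} \<Longrightarrow> (e' i - e i) / k = - diff_op N e' i - \<gamma> i * e' i / (grid N i)\<^sup>2 + \<rho> i"
    and \<rho>: "\<And>i. i \<in> {1..N} \<Longrightarrow> \<bar>\<rho> i\<bar> \<le> (\<kappa> * \<bar>e i\<bar> + R) / grid N i"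
  shows "mesh N * (\<Sum>i=1..N. grid N i * (e' i)\<^sup>2)
    \<le> (1 + 2 * k * \<kappa>\<^sup>2) * (mesh N * (\<Sum>i=1..N. grid N i * (e i)\<^sup>2)) + 2 * k * R\<^sup>2"
proof -
  have "grid N i * (e' i)\<^sup>2 \<le> (1 + 2 * k * \<kappa>\<^sup>2) * (grid N i * (e i)\<^sup>2) + 2 * k * R\<^sup>2 * grid N i
      - 2 * k * (grid N i * diff_op N e' i * e' i)" if i: "i \<in> {1..N}" for i
  proof -
    define x a b L where "x = grid N i" and "a = e i" and "b = e' i" and "L = diff_op N e' i"
    have x: "0 < x" using i by (simp add: x_def grid_pos)
    have eq: "b - a = k * (- L - \<gamma> i * b / x\<^sup>2 + \<rho> i)"
      using step[OF i] k by (simp add: x_def a_def b_def L_def field_simps)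
    \<comment> \<open>From 2 (b - a) b = b^2 - a^2 + (b - a)^2.\<close>
    have "x * b\<^sup>2 - x * a\<^sup>2 \<le> 2 * (x * (b - a) * b)"
      using mult_nonneg_nonneg[OF less_imp_le[OF x] zero_le_power2[of "b - a"]]
      by (simp add: power2_eq_square algebra_simps)
    also have "x * (b - a) * b = k * (- (x * L * b) - \<gamma> i * (b\<^sup>2 / x) + x * \<rho> i * b)"
      unfolding eq using x by (simp add: field_simps power2_eq_square)
    also have "\<dots> \<le> k * (- (x * L * b) + x * \<kappa>\<^sup>2 * a\<^sup>2 + x * R\<^sup>2)"
    proof (rule mult_left_mono)
      have "x * \<rho> i * b \<le> \<bar>x * \<rho> i * b\<bar>" by simp
      also have "\<dots> = x * \<bar>\<rho> i\<bar> * \<bar>b\<bar>" using x by (simp add: abs_mult)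
      also have "\<dots> \<le> x * ((\<kappa> * \<bar>a\<bar> + R) / x) * \<bar>b\<bar>"
        using \<rho>[OF i] x by (intro mult_right_mono mult_left_mono) (auto simp: x_def a_def)
      also have "\<dots> = (\<kappa> * \<bar>a\<bar> + R) * \<bar>b\<bar>" using x by simp
      \<comment> \<open>Young's inequality, scaled with x so that the first term is exactly what
        \<gamma> \<ge> 1/2 can absorb.\<close>
      also have "\<dots> \<le> b\<^sup>2 / (2 * x) + x * (\<kappa> * \<bar>a\<bar> + R)\<^sup>2 / 2"
      proof -
        have "0 \<le> (\<bar>b\<bar> - x * (\<kappa> * \<bar>a\<bar> + R))\<^sup>2 / (2 * x)" using x by simp
        also have "\<dots> = b\<^sup>2 / (2 * x) - (\<kappa> * \<bar>a\<bar> + R) * \<bar>b\<bar> + x * (\<kappa> * \<bar>a\<bar> + R)\<^sup>2 / 2"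
        proof -
          have "(\<bar>b\<bar> - x * c)\<^sup>2 / (2 * x) = b\<^sup>2 / (2 * x) - c * \<bar>b\<bar> + x * c\<^sup>2 / 2" for c
            using x by (simp add: power2_diff power_mult_distrib diff_divide_distrib add_divide_distrib)
              (simp add: power2_eq_square)
          then show ?thesis by simp
        qed
        finally show ?thesis by simp
      qed
      also have "(\<kappa> * \<bar>a\<bar> + R)\<^sup>2 \<le> 2 * (\<kappa>\<^sup>2 * a\<^sup>2 + R\<^sup>2)"
      proof -
        have "0 \<le> (\<kappa> * \<bar>a\<bar> - R)\<^sup>2" by simp
        moreover have "(\<kappa> * \<bar>a\<bar>)\<^sup>2 = \<kappa>\<^sup>2 * a\<^sup>2" by (simp add: power_mult_distrib)
        ultimately show ?thesis by (simp add: power2_diff power2_sum)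
      qed
      finally have "x * \<rho> i * b \<le> b\<^sup>2 / (2 * x) + x * (\<kappa>\<^sup>2 * a\<^sup>2 + R\<^sup>2)"
        using x by (simp add: distrib_left add_divide_distrib)
      moreover have "b\<^sup>2 / (2 * x) \<le> \<gamma> i * (b\<^sup>2 / x)"
        using mult_right_mono[OF \<gamma>[OF i], of "b\<^sup>2 / x"] x by simp
      ultimately show "- (x * L * b) - \<gamma> i * (b\<^sup>2 / x) + x * \<rho> i * b
          \<le> - (x * L * b) + x * \<kappa>\<^sup>2 * a\<^sup>2 + x * R\<^sup>2"
        by (simp add: distrib_left mult.assoc)
    qed (use k in simp)
    finally show ?thesis
      by (simp add: x_def a_def b_def L_def algebra_simps)
  qed
  then have "(\<Sum>i=1..N. grid N i * (e' i)\<^sup>2)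
      \<le> (\<Sum>i=1..N. (1 + 2 * k * \<kappa>\<^sup>2) * (grid N i * (e i)\<^sup>2) + 2 * k * R\<^sup>2 * grid N i
          - 2 * k * (grid N i * diff_op N e' i * e' i))"
    by (intro sum_mono) auto
  also have "\<dots> = (1 + 2 * k * \<kappa>\<^sup>2) * (\<Sum>i=1..N. grid N i * (e i)\<^sup>2) + 2 * k * R\<^sup>2 * (\<Sum>i=1..N. grid N i)
      - 2 * k * dirichlet_form N e' e'"
    by (simp only: sum.distrib sum_subtractf sum_diff_op[OF e', symmetric] sum_distrib_left)
  also have "\<dots> \<le> (1 + 2 * k * \<kappa>\<^sup>2) * (\<Sum>i=1..N. grid N i * (e i)\<^sup>2) + 2 * k * R\<^sup>2 * (\<Sum>i=1..N. grid N i)"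
    using dirichlet_form_nonneg[of N e'] k by simp
  finally have "mesh N * (\<Sum>i=1..N. grid N i * (e' i)\<^sup>2)
      \<le> mesh N * ((1 + 2 * k * \<kappa>\<^sup>2) * (\<Sum>i=1..N. grid N i * (e i)\<^sup>2) + 2 * k * R\<^sup>2 * (\<Sum>i=1..N. grid N i))"
    by (rule mult_left_mono) simp
  also have "\<dots> = (1 + 2 * k * \<kappa>\<^sup>2) * (mesh N * (\<Sum>i=1..N. grid N i * (e i)\<^sup>2))
      + 2 * k * R\<^sup>2 * (mesh N * (\<Sum>i=1..N. grid N i))"
    by (simp only: distrib_left mult_ac)
  \<comment> \<open>The Riemann sum of x over the unit interval is at most 1.\<close>
  also have "\<dots> \<le> (1 + 2 * k * \<kappa>\<^sup>2) * (mesh N * (\<Sum>i=1..N. grid N i * (e i)\<^sup>2)) + 2 * k * R\<^sup>2 * 1"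
  proof (intro add_left_mono mult_left_mono)
    have "(\<Sum>i=1..N. grid N i) \<le> (\<Sum>i=1..N. 1)"
      using grid_bounds[of _ N] by (intro sum_mono) auto
    then have "mesh N * (\<Sum>i=1..N. grid N i) \<le> mesh N * real N"
      by (intro mult_left_mono) auto
    also have "\<dots> \<le> 1" by (simp add: mesh_def field_simps)
    finally show "mesh N * (\<Sum>i=1..N. grid N i) \<le> 1" .
  qed (use k in auto)
  finally show ?thesis by simp
qed

text \<open>A discrete Gronwall inequality, from 1 + a \<le> exp a. When a and b are proportional to
  the time step, the bound is uniform in the number of steps up to time T.\<close>

lemma linear_recursion_bound:
  fixes S :: "nat \<Rightarrow> real"
  assumes "S 0 = 0" "0 \<le> a" "0 \<le> b" "\<And>n. n < M \<Longrightarrow> S (Suc n) \<le> (1 + a) * S n + b" "n \<le> M"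
  shows "S n \<le> real n * b * exp (real n * a)"
  using assms(5)
proof (induction n)
  case (Suc n)
  have "S (Suc n) \<le> (1 + a) * S n + b" using assms(4) Suc.prems by simp
  also have "\<dots> \<le> exp a * (real n * b * exp (real n * a)) + b * exp (real (Suc n) * a)"
  proof (intro add_mono)
    have "0 \<le> real n * b * exp (real n * a)" using assms(3) by simp
    then show "(1 + a) * S n \<le> exp a * (real n * b * exp (real n * a))"
      using Suc assms(2) by (intro order_trans[OF mult_left_mono mult_right_mono]) auto
    show "b \<le> b * exp (real (Suc n) * a)"
      using mult_left_mono[of 1 "exp (real (Suc n) * a)" b] assms(2,3) by simp
  qed
  also have "\<dots> = real (Suc n) * b * exp (real (Suc n) * a)"
    by (simp add: algebra_simps exp_add)
  finally show ?case .
qed (use assms(1) in simp)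

section \<open>Taylor estimates for the continuous solution and consistency in space\<close>

lemma partial_x_deriv:
  assumes "sufficiently_smooth T u" "j < 4" "x \<in> {0..1}" "t \<in> {0..T}"
  shows "((\<lambda>y. partial_x j u y t) has_field_derivative partial_x (Suc j) u x t) (at x within {0..1})"
  using assms by (simp add: sufficiently_smooth_def has_real_derivative_iff_has_vector_derivative
      vector_derivative_works[symmetric])

lemma partial_t_deriv:
  assumes "sufficiently_smooth T u" "j < 2" "x \<in> {0..1}" "t \<in> {0..T}"
  shows "((\<lambda>s. partial_t T j u x s) has_field_derivative partial_t T (Suc j) u x t) (at t within {0..T})"
  using assms by (simp add: sufficiently_smooth_def has_real_derivative_iff_has_vector_derivative
      vector_derivative_works[symmetric])

text \<open>Compactness of the rectangle makes the set of values bounded above, without which the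
  real supremum carries no information.\<close>

lemma abs_le_Linf_norm:
  assumes "continuous_on ({0..1} \<times> {0..T}) (\<lambda>(x, t). w x t)" "x \<in> {0..1}" "t \<in> {0..T}"
  shows "\<bar>w x t\<bar> \<le> Linf_norm T w"
proof -
  have "compact ((\<lambda>(x, t). \<bar>w x t\<bar>) ` ({0..1} \<times> {0..T}))"
    using continuous_on_rabs[OF assms(1)]
    by (intro compact_continuous_image compact_Times compact_Icc) (simp add: case_prod_unfold)
  then have "bdd_above ((\<lambda>(x, t). \<bar>w x t\<bar>) ` ({0..1} \<times> {0..T}))"
    by (intro bounded_imp_bdd_above compact_imp_bounded)
  from cSUP_upper[OF _ this, of "(x, t)"] show ?thesis
    using assms(2,3) by (simp add: Linf_norm_def)
qed

lemma partial_x_bound: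
  assumes "sufficiently_smooth T u" "j \<le> 4" "x \<in> {0..1}" "t \<in> {0..T}"
  shows "\<bar>partial_x j u x t\<bar> \<le> Linf_norm T (partial_x j u)"
  using assms by (intro abs_le_Linf_norm) (auto simp: sufficiently_smooth_def)

lemma partial_t_bound:
  assumes "sufficiently_smooth T u" "j \<le> 2" "x \<in> {0..1}" "t \<in> {0..T}"
  shows "\<bar>partial_t T j u x t\<bar> \<le> Linf_norm T (partial_t T j u)"
  using assms by (intro abs_le_Linf_norm) (auto simp: sufficiently_smooth_def)

text \<open>The remainder has the form of \<open>field_Taylor\<close>, with \<open>fact n\<close>
  rather than \<open>fact (Suc n)\<close> in the denominator.\<close>

lemma partial_x_Taylor:
  assumes "sufficiently_smooth T u" "n < 4" "w \<in> {0..1}" "z \<in> {0..1}" "t \<in> {0..T}"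
  shows "\<bar>u z t - (\<Sum>i\<le>n. partial_x i u w t * (z - w) ^ i / fact i)\<bar>
    \<le> Linf_norm T (partial_x (Suc n) u) * \<bar>z - w\<bar> ^ Suc n / fact n"
  using field_Taylor[where f = "\<lambda>i y. partial_x i u y t" and S = "{0..1}" and n = n
      and B = "Linf_norm T (partial_x (Suc n) u)" and w = w and z = z]
    partial_x_deriv[OF assms(1) _ _ assms(5)] partial_x_bound[OF assms(1) _ _ assms(5)] assms
  by (simp del: partial_x.simps(2))

lemma partial_t_Taylor:
  assumes "sufficiently_smooth T u" "n < 2" "x \<in> {0..1}" "w \<in> {0..T}" "z \<in> {0..T}"
  shows "\<bar>u x z - (\<Sum>i\<le>n. partial_t T i u x w * (z - w) ^ i / fact i)\<bar>
    \<le> Linf_norm T (partial_t T (Suc n) u) * \<bar>z - w\<bar> ^ Suc n / fact n"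
  using field_Taylor[where f = "\<lambda>i s. partial_t T i u x s" and S = "{0..T}" and n = n
      and B = "Linf_norm T (partial_t T (Suc n) u)" and w = w and z = z]
    partial_t_deriv[OF assms(1) _ assms(3)] partial_t_bound[OF assms(1) _ assms(3)] assms
  by (simp del: partial_t.simps(2))

lemma diff_op_diff: "diff_op N (\<lambda>i. v i - w i) i = diff_op N v i - diff_op N w i"
  by (simp add: diff_op_def diff_divide_distrib add_divide_distrib algebra_simps)

text \<open>\<open>A\<close> and \<open>B\<close> are the errors of the central second and first
  differences, both of order h^2. \<open>B\<close> enters divided by x; the bound for
  \<open>A\<close> is weakened by the same factor, using x \<le> 1, to fit the residual form in
  \<open>error_step\<close>.\<close>

lemma diff_op_consistent:
  assumes u: "sufficiently_smooth T u" and t: "t \<in> {0..T}" and i: "i \<in> {1..N}"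
  defines "x \<equiv> grid N i"
  shows "\<bar>diff_op N (\<lambda>i. u (grid N i) t) i + partial_x 2 u x t + 1 / x * partial_x 1 u x t\<bar>
    \<le> (Linf_norm T (partial_x 4 u) + Linf_norm T (partial_x 3 u)) * (mesh N)\<^sup>2 / x"
proof -
  define h where "h = mesh N"
  define X3 X4 where "X3 = Linf_norm T (partial_x 3 u)" and "X4 = Linf_norm T (partial_x 4 u)"
  define p where "p j = partial_x j u x t" for j
  have h: "0 < h" by (simp add: h_def)
  have x: "0 < x" "x \<in> {0..1}" using i grid_bounds[of i N] by (auto simp: x_def grid_pos)
  have nb: "grid N (i - 1) = x - h" "grid N (i + 1) = x + h"
    using i by (auto simp: grid_def x_def h_def algebra_simps of_nat_diff)
  have xm: "x - h \<in> {0..1}" and xp: "x + h \<in> {0..1}"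
    using grid_bounds[of "i - 1" N] grid_bounds[of "i + 1" N] i unfolding nb by auto
  define A where "A = (2 * p 0 - u (x - h) t - u (x + h) t) / h\<^sup>2 + p 2"
  define B where "B = p 1 - (u (x + h) t - u (x - h) t) / (2 * h)"
  have p0: "u x t = p 0" by (simp add: p_def)
  have X: "0 \<le> X3" "0 \<le> X4"
    using partial_x_bound[OF u _ x(2) t, of 3] partial_x_bound[OF u _ x(2) t, of 4]
    by (auto simp: X3_def X4_def simp del: partial_x.simps intro: order_trans[OF abs_ge_zero])
  have sum2: "(\<Sum>i\<le>2. g i) = g 0 + g 1 + g 2"
    and sum3: "(\<Sum>i\<le>3. g i) = g 0 + g 1 + g 2 + g 3" for g :: "nat \<Rightarrow> real"
    by (simp_all add: numeral_2_eq_2 numeral_3_eq_3)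
  have fact3: "fact 3 = (6 :: real)" by (simp add: fact_numeral)
  have A: "\<bar>A\<bar> \<le> X4 * h\<^sup>2"
  proof -
    have "\<bar>u (x + h) t - (p 0 + p 1 * h + p 2 * h\<^sup>2 / 2 + p 3 * h ^ 3 / 6)\<bar> \<le> X4 * h ^ 4 / 6"
      using partial_x_Taylor[OF u _ x(2) xp t, of 3, unfolded sum3] h
      by (simp add: fact3 p_def X4_def del: partial_x.simps)
    moreover have "\<bar>u (x - h) t - (p 0 - p 1 * h + p 2 * h\<^sup>2 / 2 - p 3 * h ^ 3 / 6)\<bar> \<le> X4 * h ^ 4 / 6"
      using partial_x_Taylor[OF u _ x(2) xm t, of 3, unfolded sum3] h
      by (simp add: fact3 p_def X4_def del: partial_x.simps)
    \<comment> \<open>Adding the two expansions cancels the terms of odd order.\<close>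
    ultimately have "\<bar>2 * p 0 - u (x - h) t - u (x + h) t + p 2 * h\<^sup>2\<bar> \<le> X4 * h ^ 4 / 3"
      by linarith
    also have "\<dots> \<le> X4 * h ^ 4" using X h by simp
    also have "2 * p 0 - u (x - h) t - u (x + h) t + p 2 * h\<^sup>2 = A * h\<^sup>2"
      using h by (simp add: A_def distrib_right)
    finally have "\<bar>A\<bar> * h\<^sup>2 \<le> (X4 * h\<^sup>2) * h\<^sup>2" by (simp add: abs_mult eval_nat_numeral)
    then show ?thesis using h by simp
  qed
  have B: "\<bar>B\<bar> \<le> X3 * h\<^sup>2"
  proof -
    have "\<bar>u (x + h) t - (p 0 + p 1 * h + p 2 * h\<^sup>2 / 2)\<bar> \<le> X3 * h ^ 3 / 2"
      using partial_x_Taylor[OF u _ x(2) xp t, of 2, unfolded sum2] h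
      by (simp add: p_def X3_def del: partial_x.simps)
    moreover have "\<bar>u (x - h) t - (p 0 - p 1 * h + p 2 * h\<^sup>2 / 2)\<bar> \<le> X3 * h ^ 3 / 2"
      using partial_x_Taylor[OF u _ x(2) xm t, of 2, unfolded sum2] h
      by (simp add: p_def X3_def del: partial_x.simps)
    \<comment> \<open>Subtracting them cancels the terms of even order.\<close>
    ultimately have "\<bar>p 1 * (2 * h) - (u (x + h) t - u (x - h) t)\<bar> \<le> X3 * h ^ 3"
      by linarith
    also have "\<dots> \<le> X3 * h ^ 3 * 2" using X h by simp
    also have "p 1 * (2 * h) - (u (x + h) t - u (x - h) t) = B * (2 * h)"
      using h by (simp add: B_def field_simps)
    finally have "\<bar>B\<bar> * (2 * h) \<le> (X3 * h\<^sup>2) * (2 * h)"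
      using h by (simp add: abs_mult eval_nat_numeral)
    then show ?thesis using h by simp
  qed
  have "diff_op N (\<lambda>i. u (grid N i) t) i + p 2 + 1 / x * p 1 = A + B / x"
    unfolding diff_op_def nb x_def[symmetric] h_def[symmetric] A_def B_def p0
    using x h by (simp add: field_simps)
  also have "\<bar>\<dots>\<bar> \<le> X4 * h\<^sup>2 + X3 * h\<^sup>2 / x"
    using A divide_right_mono[OF B, of x] x by (intro order_trans[OF abs_triangle_ineq add_mono]) auto
  also have "\<dots> \<le> X4 * h\<^sup>2 / x + X3 * h\<^sup>2 / x"
    using x X h divide_left_mono[of x 1 "X4 * h\<^sup>2"] by simp
  also have "\<dots> = (X4 + X3) * h\<^sup>2 / x"
    by (simp add: add_divide_distrib distrib_right)
  finally show ?thesis by (simp add: p_def X3_def X4_def h_def del: partial_x.simps)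
qed

text \<open>The lists hold the norms of the space and of the time derivatives, indexed by order.\<close>

definition consistency_const :: "real list \<Rightarrow> real list \<Rightarrow> real" where
  "consistency_const X Y = X ! 4 + X ! 3 + Y ! 2 + 2 * X ! 1 * Y ! 1"

text \<open>The continuous solution satisfies the scheme up to a residual of the form required by
  \<open>error_step\<close>, with \<kappa> = 2 * \<open>X ! 1\<close>. The recursion starts at zero
  error, and the exponent 8 T (\<open>X ! 1\<close>)^2 is 2 T \<kappa>^2.\<close>

lemma error_bound:
  assumes sol: "discrete_solution T u0 N M U" and pos: "0 < T" "1 \<le> N" "1 \<le> M"
    and init: "max_norm (U 0) \<le> pi / 4"
    and u: "sufficiently_smooth T u" and cs: "continuous_solution T u0 u"
  defines "k \<equiv> T / real M"
  defines "X \<equiv> map (\<lambda>j. Linf_norm T (partial_x j u)) [0..<5]"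
  defines "Y \<equiv> map (\<lambda>j. Linf_norm T (partial_t T j u)) [0..<3]"
  assumes m: "m \<le> M"
  shows "(Dh_norm N (grid_values N (\<lambda>x. u x (real m * k)) - U m))\<^sup>2
    \<le> 2 * T * exp (8 * T * (X ! 1)\<^sup>2) * (consistency_const X Y * (k + (mesh N)\<^sup>2))\<^sup>2"
proof -
  define e where "e n i = u (grid N i) (real n * k) - ext (U n) i" for n i
  define S where "S n = mesh N * (\<Sum>i=1..N. grid N i * (e n i)\<^sup>2)" for n
  define R where "R = consistency_const X Y * (k + (mesh N)\<^sup>2)"
  have k: "0 < k" using pos by (simp add: k_def)
  have U: "U n \<in> carrier_vec N" if "n \<le> M" for n
    using sol that unfolding discrete_solution_def by blast
  have Xj: "X ! j = Linf_norm T (partial_x j u)" if "j \<le> 4" for j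
    using that by (simp add: X_def del: upt_Suc)
  have Yj: "Y ! j = Linf_norm T (partial_t T j u)" if "j \<le> 2" for j
    using that by (simp add: Y_def del: upt_Suc)
  have X0: "0 \<le> X ! j" if "j \<le> 4" for j
    using partial_x_bound[OF u that, of 0 0] Xj[OF that] pos by (auto intro: order_trans[OF abs_ge_zero])
  have Y0: "0 \<le> Y ! j" if "j \<le> 2" for j
    using partial_t_bound[OF u that, of 0 0] Yj[OF that] pos by (auto intro: order_trans[OF abs_ge_zero])
  have R: "0 \<le> R"
    using X0 Y0 k by (simp add: R_def consistency_const_def)
  have time: "real n * k \<in> {0..T}" if "n \<le> M" for n
  proof -
    have "real n * k \<le> real M * k" using that k by simp
    then show ?thesis using k pos by (simp add: k_def)
  qed
  have e_boundary: "e n 0 = 0" "e n (Suc N) = 0" if "n \<le> M" for n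
  proof -
    have "grid N (Suc N) = 1" by (simp add: grid_def mesh_def)
    then show "e n 0 = 0" "e n (Suc N) = 0"
      using cs time[OF that] ext_Suc_dim[OF U[OF that]]
      by (auto simp: e_def continuous_solution_def grid_def[of N 0])
  qed
  have step: "S (Suc n) \<le> (1 + 2 * k * (2 * X ! 1)\<^sup>2) * S n + 2 * k * R\<^sup>2" if n: "n < M" for n
    unfolding S_def
  proof (rule error_step)
    define t t' where "t = real n * k" and "t' = real (Suc n) * k"
    have t: "t \<in> {0..T}" "t' \<in> {0..T}" "t' = t + k"
      using time[of n] time[of "Suc n"] n by (auto simp: t_def t'_def algebra_simps)
    define \<gamma> where "\<gamma> i = sin_quot (ext (U n) i)" for i
    \<comment> \<open>Defined as the residual of the error in the linearized scheme, so the error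
      equation is immediate and the work lies in bounding it.\<close>
    define \<rho> where "\<rho> i = (e (Suc n) i - e n i) / k + diff_op N (e (Suc n)) i
      + \<gamma> i * e (Suc n) i / (grid N i)\<^sup>2" for i
    show "(e (Suc n) i - e n i) / k = - diff_op N (e (Suc n)) i - \<gamma> i * e (Suc n) i / (grid N i)\<^sup>2 + \<rho> i" for i
      by (simp add: \<rho>_def)
    fix i assume i: "i \<in> {1..N}"
    show "1 / 2 \<le> \<gamma> i"
      unfolding \<gamma>_def using n by (intro sin_quot_ge_half discrete_solution_bounded[OF sol pos init _ i]) simp
    define x where "x = grid N i"
    have x: "0 < x" "x \<in> {0..1}" using i grid_bounds[of i N] by (auto simp: x_def grid_pos)
    \<comment> \<open>The residual splits into the errors of the backward time difference, of the
      space differences, and of evaluating \<open>sin_quot\<close> at the old discrete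
      value.\<close>
    define \<tau>\<^sub>1 where "\<tau>\<^sub>1 = (u x t' - u x t) / k - partial_t T 1 u x t'"
    define \<tau>\<^sub>2 where "\<tau>\<^sub>2 = diff_op N (\<lambda>i. u (grid N i) t') i + partial_x 2 u x t' + 1 / x * partial_x 1 u x t'"
    define \<tau>\<^sub>3 where "\<tau>\<^sub>3 = (sin_quot (u x t') - \<gamma> i) * u x t' / x\<^sup>2"
    have "\<rho> i = \<tau>\<^sub>1 + \<tau>\<^sub>2 - \<tau>\<^sub>3"
    proof -
      have pde: "partial_t T 1 u x t' = partial_x 2 u x t' + 1 / x * partial_x 1 u x t'
          - sin (2 * u x t') / (2 * x\<^sup>2)"
        using cs x t(2) unfolding continuous_solution_def by auto
      have "sin (2 * u x t') / (2 * x\<^sup>2) = sin_quot (u x t') * u x t' / x\<^sup>2"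
        by (simp flip: sin_quot_mult)
      moreover have "(ext (U (Suc n)) i - ext (U n) i) / k
          = - diff_op N (ext (U (Suc n))) i - \<gamma> i * ext (U (Suc n)) i / x\<^sup>2"
        using discrete_solution_pointwise[OF sol n i] by (simp add: k_def x_def \<gamma>_def)
      moreover have "(e (Suc n) i - e n i) / k = (u x t' - u x t) / k - (ext (U (Suc n)) i - ext (U n) i) / k"
        by (simp add: e_def x_def t_def t'_def diff_divide_distrib)
      moreover have "diff_op N (e (Suc n)) i = diff_op N (\<lambda>i. u (grid N i) t') i - diff_op N (ext (U (Suc n))) i"
        by (simp add: e_def[abs_def] t'_def diff_op_diff)
      moreover have "\<gamma> i * e (Suc n) i / x\<^sup>2 = \<gamma> i * u x t' / x\<^sup>2 - \<gamma> i * ext (U (Suc n)) i / x\<^sup>2"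
        by (simp add: e_def x_def t'_def diff_divide_distrib right_diff_distrib)
      moreover have "\<tau>\<^sub>3 = sin_quot (u x t') * u x t' / x\<^sup>2 - \<gamma> i * u x t' / x\<^sup>2"
        by (simp add: \<tau>\<^sub>3_def diff_divide_distrib left_diff_distrib)
      ultimately show ?thesis
        using pde unfolding \<rho>_def \<tau>\<^sub>1_def \<tau>\<^sub>2_def x_def[symmetric] by linarith
    qed
    moreover have "\<bar>\<tau>\<^sub>1\<bar> \<le> Y ! 2 * k / x"
    proof -
      \<comment> \<open>The expansion is about the new time t', where the implicit scheme is
        compared with the differential equation.\<close>
      have "\<bar>u x t - (u x t' - partial_t T 1 u x t' * k)\<bar> \<le> Y ! 2 * k\<^sup>2"
        using partial_t_Taylor[OF u _ x(2) t(2) t(1), of 1] k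
        by (simp add: t(3) Yj power2_eq_square numeral_2_eq_2 del: partial_t.simps(2))
      also have "u x t - (u x t' - partial_t T 1 u x t' * k) = - (\<tau>\<^sub>1 * k)"
        using k by (simp add: \<tau>\<^sub>1_def field_simps)
      finally have "\<bar>\<tau>\<^sub>1 * k\<bar> \<le> Y ! 2 * k\<^sup>2" by simp
      then have "\<bar>\<tau>\<^sub>1\<bar> * k \<le> (Y ! 2 * k) * k"
        using k by (simp add: abs_mult power2_eq_square)
      then have "\<bar>\<tau>\<^sub>1\<bar> \<le> Y ! 2 * k" using k by simp
      also have "\<dots> \<le> Y ! 2 * k / x"
        using x Y0[of 2] k divide_left_mono[of x 1 "Y ! 2 * k"] by simp
      finally show ?thesis .
    qed
    moreover have "\<bar>\<tau>\<^sub>2\<bar> \<le> (X ! 4 + X ! 3) * (mesh N)\<^sup>2 / x"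
      using diff_op_consistent[OF u t(2) i] by (simp add: \<tau>\<^sub>2_def x_def Xj)
    \<comment> \<open>The denominator is x^2, but u vanishes at x = 0 and is therefore at most
      \<open>X ! 1\<close> * x in size, so one power of x cancels. The time lag contributes
      \<open>Y ! 1\<close> * k and the discrete error \<bar>e\<bar>, both through the Lipschitz
      bound.\<close>
    moreover have "\<bar>\<tau>\<^sub>3\<bar> \<le> (2 * (Y ! 1 * k + \<bar>e n i\<bar>)) * X ! 1 / x"
    proof -
      have "\<bar>u x t' - u x t\<bar> \<le> Y ! 1 * k"
        using partial_t_Taylor[OF u _ x(2) t(1) t(2), of 0] k by (simp add: t(3) Yj)
      then have "\<bar>u x t' - ext (U n) i\<bar> \<le> Y ! 1 * k + \<bar>e n i\<bar>"
        by (simp add: e_def x_def t_def)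
      then have g: "\<bar>sin_quot (u x t') - \<gamma> i\<bar> \<le> 2 * (Y ! 1 * k + \<bar>e n i\<bar>)"
        unfolding \<gamma>_def by (intro order_trans[OF sin_quot_lipschitz]) simp
      have "u 0 t' = 0" using cs t(2) by (simp add: continuous_solution_def)
      then have "\<bar>u x t'\<bar> \<le> X ! 1 * x"
        using partial_x_Taylor[OF u _ _ x(2) t(2), of 0 0] x by (simp add: Xj)
      with g have "\<bar>(sin_quot (u x t') - \<gamma> i) * u x t'\<bar> \<le> (2 * (Y ! 1 * k + \<bar>e n i\<bar>)) * (X ! 1 * x)"
        unfolding abs_mult using x by (intro mult_mono) auto
      then have "\<bar>\<tau>\<^sub>3\<bar> \<le> (2 * (Y ! 1 * k + \<bar>e n i\<bar>)) * (X ! 1 * x) / x\<^sup>2"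
        unfolding \<tau>\<^sub>3_def abs_divide using x by (simp add: divide_right_mono)
      also have "\<dots> = (2 * (Y ! 1 * k + \<bar>e n i\<bar>)) * X ! 1 / x"
        using x by (simp add: power2_eq_square)
      finally show ?thesis .
    qed
    ultimately have "\<bar>\<rho> i\<bar> \<le> Y ! 2 * k / x + (X ! 4 + X ! 3) * (mesh N)\<^sup>2 / x
        + (2 * (Y ! 1 * k + \<bar>e n i\<bar>)) * X ! 1 / x"
      by linarith
    also have "\<dots> = (Y ! 2 * k + (X ! 4 + X ! 3) * (mesh N)\<^sup>2 + (2 * (Y ! 1 * k + \<bar>e n i\<bar>)) * X ! 1) / x"
      by (simp add: add_divide_distrib)
    also have "\<dots> \<le> (2 * X ! 1 * \<bar>e n i\<bar> + R) / x"
    proof (rule divide_right_mono)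
      \<comment> \<open>These are the mixed products by which R exceeds the actual terms, since its
        constant multiplies both k and h^2.\<close>
      have "0 \<le> (X ! 4 + X ! 3) * k + (Y ! 2 + 2 * X ! 1 * Y ! 1) * (mesh N)\<^sup>2"
        using X0 Y0 k by simp
      then show "Y ! 2 * k + (X ! 4 + X ! 3) * (mesh N)\<^sup>2 + (2 * (Y ! 1 * k + \<bar>e n i\<bar>)) * X ! 1
          \<le> 2 * X ! 1 * \<bar>e n i\<bar> + R"
        by (simp add: R_def consistency_const_def algebra_simps)
    qed (use x in simp)
    finally show "\<bar>\<rho> i\<bar> \<le> (2 * X ! 1 * \<bar>e n i\<bar> + R) / grid N i" by (simp add: x_def)
  qed (use e_boundary n k R X0 in auto)
  have "S 0 = 0"
  proof -
    have "e 0 i = 0" if "i \<in> {1..N}" for i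
    proof -
      have "U 0 = grid_values N u0" using sol unfolding discrete_solution_def by blast
      then have "ext (U 0) i = u0 (grid N i)" using that by (auto simp: ext_def grid_values_def)
      then show ?thesis
        using cs grid_bounds[of i N] that by (auto simp: e_def continuous_solution_def)
    qed
    then show ?thesis by (simp add: S_def)
  qed
  then have "S m \<le> real m * (2 * k * R\<^sup>2) * exp (real m * (2 * k * (2 * X ! 1)\<^sup>2))"
    using k step m by (intro linear_recursion_bound[of S _ _ M]) auto
  also have "\<dots> = 2 * (real m * k) * R\<^sup>2 * exp (8 * (real m * k) * (X ! 1)\<^sup>2)"
    by (simp add: power_mult_distrib algebra_simps)
  also have "\<dots> \<le> 2 * T * R\<^sup>2 * exp (8 * T * (X ! 1)\<^sup>2)"
  proof -
    have "8 * (real m * k) * (X ! 1)\<^sup>2 \<le> 8 * T * (X ! 1)\<^sup>2"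
      using time[OF m] by (intro mult_right_mono mult_left_mono) auto
    then show ?thesis
      using time[OF m] pos k by (intro mult_mono mult_nonneg_nonneg) auto
  qed
  finally have "S m \<le> 2 * T * exp (8 * T * (X ! 1)\<^sup>2) * R\<^sup>2" by (simp add: algebra_simps)
  moreover have "(Dh_norm N (grid_values N (\<lambda>x. u x (real m * k)) - U m))\<^sup>2 = S m"
  proof -
    have "ext (grid_values N (\<lambda>x. u x (real m * k)) - U m) i = e m i" if "i \<in> {1..N}" for i
      using that U[OF m] by (auto simp: ext_def e_def grid_values_def)
    then show ?thesis
      using U[OF m] by (subst Dh_norm_squared) (auto simp: S_def grid_values_def)
  qed
  ultimately show ?thesis by (simp add: R_def)
qed

section \<open>The constant and the stated estimates\<close>

text \<open>The factor 2 pays for replacing h^2 by h^2 \<bar>ln h\<bar>^(1/2); the absolute value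
  comes from the root of a square.\<close>

definition error_const :: "real list \<Rightarrow> real list \<Rightarrow> real \<Rightarrow> real" where
  "error_const X Y T = 2 * sqrt (2 * T * exp (8 * T * (X ! 1)\<^sup>2)) * \<bar>consistency_const X Y\<bar>"

text \<open>With N \<ge> 1 the mesh size is at most 1/2, so \<bar>ln h\<bar> \<ge> ln 2 \<ge> 1/4
  and its root is at least 1/2.\<close>

lemma mesh_squared_le_log:
  assumes "1 \<le> N"
  shows "(mesh N)\<^sup>2 \<le> 2 * ((mesh N)\<^sup>2 * \<bar>ln (mesh N)\<bar> powr (1 / 2))"
proof -
  have "1 / 4 \<le> ln (2 :: real)"
    using ln2_ge_two_thirds by linarith
  also have "\<dots> \<le> ln (real N + 1)" using assms by simp
  also have "\<dots> = \<bar>ln (mesh N)\<bar>" using assms by (simp add: mesh_def ln_div)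
  finally have "sqrt (1 / 4) \<le> sqrt \<bar>ln (mesh N)\<bar>" by (rule real_sqrt_le_mono)
  then have "1 \<le> 2 * \<bar>ln (mesh N)\<bar> powr (1 / 2)"
    by (simp add: powr_half_sqrt real_sqrt_divide)
  from mult_left_mono[OF this, of "(mesh N)\<^sup>2"] show ?thesis by simp
qed

lemma error_estimate:
  assumes sol: "discrete_solution T u0 N M U" and pos: "0 < T" "1 \<le> N" "1 \<le> M"
    and init: "max_norm (U 0) \<le> pi / 4"
    and u: "sufficiently_smooth T u" and cs: "continuous_solution T u0 u" and m: "m \<le> M"
  shows "Dh_norm N (grid_values N (\<lambda>x. u x (real m * (T / real M))) - U m)
    \<le> error_const (map (\<lambda>j. Linf_norm T (partial_x j u)) [0..<5])
        (map (\<lambda>j. Linf_norm T (partial_t T j u)) [0..<3]) T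
      * (T / real M + (mesh N)\<^sup>2 * \<bar>ln (mesh N)\<bar> powr (1 / 2))"
proof -
  define X where "X = map (\<lambda>j. Linf_norm T (partial_x j u)) [0..<5]"
  define Y where "Y = map (\<lambda>j. Linf_norm T (partial_t T j u)) [0..<3]"
  define k where "k = T / real M"
  define K where "K = 2 * T * exp (8 * T * (X ! 1)\<^sup>2)"
  have k: "0 < k" and K: "0 \<le> K" using pos by (simp_all add: k_def K_def)
  have "Dh_norm N (grid_values N (\<lambda>x. u x (real m * k)) - U m)
      \<le> sqrt (K * (consistency_const X Y * (k + (mesh N)\<^sup>2))\<^sup>2)"
    using error_bound[OF sol pos init u cs m] unfolding k_def K_def X_def Y_def by (rule real_le_rsqrt)
  also have "\<dots> = sqrt K * \<bar>consistency_const X Y\<bar> * (k + (mesh N)\<^sup>2)"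
    using k by (simp add: real_sqrt_mult abs_mult)
  also have "\<dots> \<le> sqrt K * \<bar>consistency_const X Y\<bar> * (2 * (k + (mesh N)\<^sup>2 * \<bar>ln (mesh N)\<bar> powr (1 / 2)))"
  proof (rule mult_left_mono)
    show "k + (mesh N)\<^sup>2 \<le> 2 * (k + (mesh N)\<^sup>2 * \<bar>ln (mesh N)\<bar> powr (1 / 2))"
    proof -
      define L where "L = (mesh N)\<^sup>2 * \<bar>ln (mesh N)\<bar> powr (1 / 2)"
      have "(mesh N)\<^sup>2 \<le> 2 * L" unfolding L_def by (rule mesh_squared_le_log[OF pos(2)])
      then have "k + (mesh N)\<^sup>2 \<le> 2 * (k + L)" using k by simp
      then show ?thesis by (simp only: L_def)
    qed
  qed (use K in simp)
  also have "\<dots> = error_const X Y T * (k + (mesh N)\<^sup>2 * \<bar>ln (mesh N)\<bar> powr (1 / 2))"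
    by (simp add: error_const_def K_def)
  finally show ?thesis by (simp add: X_def Y_def k_def)
qed

text \<open>The maximum principle supplies the bound pi/4 that \<open>energy_decreasing\<close> asks
  of the old iterate.\<close>

lemma discrete_solution_energy_decreasing:
  assumes sol: "discrete_solution T u0 N M U" and pos: "0 < T" "1 \<le> N" "1 \<le> M"
    and init: "max_norm (U 0) \<le> pi / 4" and n: "n < M"
  shows "energy N (U (n + 1)) \<le> energy N (U n)"
proof (rule energy_decreasing)
  show "U n \<in> carrier_vec N" "U (n + 1) \<in> carrier_vec N"
    using sol n unfolding discrete_solution_def by auto
  show "\<bar>ext (U n) i\<bar> \<le> pi / 4" if "i \<in> {1..N}" for i
    using discrete_solution_bounded[OF sol pos init _ that] n by simp
  show "0 < T / real M" using pos by simp
  show "(ext (U (n + 1)) i - ext (U n) i) / (T / real M) = - diff_op N (ext (U (n + 1))) i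
     - sin_quot (ext (U n) i) * ext (U (n + 1)) i / (grid N i)\<^sup>2" if "i \<in> {1..N}" for i
    using discrete_solution_pointwise[OF sol n that] by simp
qed

theorem lemma5p1:
  fixes \<alpha> c\<^sub>\<alpha> :: real
  assumes "0 \<le> \<alpha>" and "\<alpha> < 1"
    and "0 < c\<^sub>\<alpha>" and "c\<^sub>\<alpha> \<le> pi / 2" and "sin (2 * c\<^sub>\<alpha>) / (2 * c\<^sub>\<alpha>) = \<alpha>\<^sup>2"
  shows
    "(\<forall>(T::real) (u0::real \<Rightarrow> real) (N::nat) (M::nat) (U::nat \<Rightarrow> real vec) (h::real) (\<Delta>t::real) (d::real).
        T > 0 \<and> N \<ge> 1 \<and> M \<ge> 1 \<and> u0 0 = 0 \<and> u0 1 = 0 \<and>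
        h = mesh N \<and> \<Delta>t = T / real M \<and>
        discrete_solution T u0 N M U \<and>
        max_norm (U 0) \<le> min (pi / 4) c\<^sub>\<alpha> \<and>
        d = max_norm (matD_powr N (- \<alpha>) *\<^sub>v U 0) \<longrightarrow>
        (\<forall>n<M. (d = 0 \<or> \<Delta>t \<le> 3 / 4 * d powi (-2) * h powr (2 * (1 - \<alpha>))) \<longrightarrow>
           energy N (U (n + 1)) \<le> energy N (U n)))
     \<and>
     (\<alpha> > 1 / 2 \<longrightarrow>
       (\<exists>const :: real list \<Rightarrow> real list \<Rightarrow> real \<Rightarrow> real \<Rightarrow> real \<Rightarrow> real \<Rightarrow> real.
         \<forall>(T::real) (u0::real \<Rightarrow> real) (N::nat) (M::nat) (U::nat \<Rightarrow> real vec) (h::real) (\<Delta>t::real) (d::real)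
           (u::real \<Rightarrow> real \<Rightarrow> real) (c::real).
          T > 0 \<and> N \<ge> 1 \<and> M \<ge> 1 \<and> u0 0 = 0 \<and> u0 1 = 0 \<and>
          h = mesh N \<and> \<Delta>t = T / real M \<and>
          discrete_solution T u0 N M U \<and>
          max_norm (U 0) \<le> min (pi / 4) c\<^sub>\<alpha> \<and>
          d = max_norm (matD_powr N (- \<alpha>) *\<^sub>v U 0) \<and>
          sufficiently_smooth T u \<and> continuous_solution T u0 u \<and>
          c = const (map (\<lambda>j. Linf_norm T (partial_x j u)) [0..<5])
                    (map (\<lambda>j. Linf_norm T (partial_t T j u)) [0..<3]) T \<alpha> c\<^sub>\<alpha> d \<longrightarrow>
          (\<forall>m\<in>{1..M}. Dh_norm N (grid_values N (\<lambda>x. u x (real m * \<Delta>t)) - U m)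
             \<le> c * (\<Delta>t + h\<^sup>2 * \<bar>ln h\<bar> powr (1 / 2))) \<and>
          (\<forall>n<M. energy N (U (n + 1)) \<le> energy N (U n)
             + 64 / 3 * c\<^sup>2 * d\<^sup>2 * (h powr (2 * (\<alpha> - 1)) * \<Delta>t\<^sup>2 + h powr (2 * (\<alpha> + 1)) * \<bar>ln h\<bar>))))"
proof (intro conjI impI, goal_cases)
  case 1
  then show ?case using discrete_solution_energy_decreasing by auto
next
  case 2
  show ?case
  \<comment> \<open>The witness is \<open>error_const\<close>, fixed before the data and evaluated
    at the two lists of norms and T.\<close>
  proof (intro exI[of _ "\<lambda>X Y T _ _ _. error_const X Y T"] allI impI conjI ballI, elim conjE, goal_cases)
    case (1 T u0 N M U h \<Delta>t d u c m)
    then show ?case using error_estimate[of T u0 N M U u m] by auto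
  next
    case (2 T u0 N M U h \<Delta>t d u c n)
    have "energy N (U (n + 1)) \<le> energy N (U n)"
      using discrete_solution_energy_decreasing[of T u0 N M U n] 2 by auto
    \<comment> \<open>The term added on the right is nonnegative, so the decrease of the energy
      implies the estimate.\<close>
    moreover have "0 \<le> 64 / 3 * c\<^sup>2 * d\<^sup>2 *
        (h powr (2 * (\<alpha> - 1)) * \<Delta>t\<^sup>2 + h powr (2 * (\<alpha> + 1)) * \<bar>ln h\<bar>)"
      by (intro mult_nonneg_nonneg add_nonneg_nonneg) auto
    ultimately show ?case by linarith
  qed
qed

end
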